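(* For all integers $n\ge 2$, $L_{\mathrm{squ}}(n)=\ell_{\mathrm{squ}}(n)$, and the asymptotic growth of $L_{\mathrm{squ}}$ is given by $L_{\mathrm{squ}}(n)\sim \frac12\, n$ as $n\to\infty$.
   Context: The square lattice is the infinite simple graph with vertex set $\mathbb{Z}^2$ in which two points are adjacent iff their Euclidean distance is $1$. A tree-like polyomino of size $n$ is a subgraph of the square lattice induced by a set of $n$ vertices (cells) which is a tree. A leaf of a tree $T$ is a vertex of degree $1$ in $T$; $n_1(T)$ denotes the number of leaves of $T$. For $n\ge 2$, $L_{\mathrm{squ}}(n)$ is the maximum of $n_1(T)$ over all tree-like polyominoes $T$ of size $n$. The function $\ell_{\mathrm{squ}}$ is defined for integers $n\ge 2$ by $\ell_{\mathrm{squ}}(2)=2$; $\ell_{\mathrm{squ}}(n)=n-1$ for $n=3,4,5$; and $\ell_{\mathrm{squ}}(n)=\ell_{\mathrm{squ}}(n-4)+2$ for $n\ge 6$. *)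

theory Defs
  imports
    "HOL-Analysis.Analysis"
    "HOL-Library.Landau_Symbols"
    "Graph_Theory.Graph_Theory"
begin

text \<open>
  As in Graph_Theory, a simple graph is a symmetric digraph without loops and parallel arcs:
  an edge between \<open>u\<close> and \<open>v\<close> is the pair of arcs \<open>(u, v)\<close>, \<open>(v, u)\<close>. The product
  metric on \<open>real \<times> real\<close> is the Euclidean distance.
\<close>

definition real_point :: "int \<times> int \<Rightarrow> real \<times> real" where
  "real_point u = (real_of_int (fst u), real_of_int (snd u))"

definition square_lattice :: "(int \<times> int) pair_pre_digraph" where
  "square_lattice = \<lparr> pverts = UNIV, parcs = {(u, v). dist (real_point u) (real_point v) = 1} \<rparr>"

text \<open>
  The library's \<^const>\<open>tree\<close> cannot be used for symmetric digraphs, because its \<^const>\<open>forest\<close>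
  regards the back-and-forth walk \<open>u, v, u\<close> along a single edge as a cycle. In a symmetric digraph
  without loops and parallel arcs, the cycles of the underlying simple graph are the directed
  cycles with at least three arcs.
\<close>

definition graph_tree :: "('a, 'b) pre_digraph \<Rightarrow> bool" where
  "graph_tree G \<longleftrightarrow>
     Digraph_Component.connected G \<and> \<not> (\<exists>p. pre_digraph.cycle G p \<and> length p \<ge> 3)"

definition tree_like_polyomino ::
    "nat \<Rightarrow> (int \<times> int, (int \<times> int) \<times> (int \<times> int)) pre_digraph \<Rightarrow> bool" where
  "tree_like_polyomino n T \<longleftrightarrow>
     induced_subgraph T (with_proj square_lattice) \<and>
     finite (verts T) \<and> card (verts T) = n \<and> graph_tree T"

text \<open>The degree of a vertex in the simple graph is its out-degree in the symmetric digraph.\<close>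

definition leaves :: "('a, 'b) pre_digraph \<Rightarrow> 'a set" where
  "leaves G = {v \<in> verts G. out_degree G v = 1}"

definition num_leaves :: "('a, 'b) pre_digraph \<Rightarrow> nat" where
  "num_leaves G = card (leaves G)"

definition L_squ :: "nat \<Rightarrow> nat" where
  "L_squ n = Max {num_leaves T | T. tree_like_polyomino n T}"

text \<open>The recursion only concerns \<open>n \<ge> 2\<close>; the value \<open>0\<close> below \<open>2\<close> is a dummy.\<close>

fun l_squ :: "nat \<Rightarrow> nat" where
  "l_squ n =
     (if n < 2 then 0
      else if n = 2 then 2
      else if n \<le> 5 then n - 1
      else l_squ (n - 4) + 2)"

declare l_squ.simps [simp del]

end

theory Submission
  imports Defs "HOL-Real_Asymp.Real_Asymp"
begin

text \<open>
  Let a tree-like polyomino have \<open>n \<ge> 2\<close> cells, and let \<open>n\<^sub>k\<close> be the number of its cells of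
  degree \<open>k\<close>, where \<open>k \<le> 4\<close>. A tree has \<open>n - 1\<close> edges, so summing the degrees gives
  \<open>2 n\<^sub>1 = n + 2 + n\<^sub>4 - n\<^sub>2\<close>. The upper bound thus asks for \<open>n\<^sub>4 \<le> n\<^sub>2 + 1\<close>.

  The geometry enters only through one fact: a neighbour of a cell of degree 4 has degree 1 or 2,
  since a third edge would close a \<open>2 \<times> 2\<close> square (\<open>nbrs_of_degree_4_cell\<close>). Now delete the
  \<open>n\<^sub>2\<close> cells of degree 2. Each deletion adds at most one component, so at most \<open>n\<^sub>2 + 1\<close> components
  remain. Each cell of degree 4 forms a component of its own together with its leaf
  neighbours, whence \<open>n\<^sub>4 \<le> n\<^sub>2 + 1\<close>. If equality holds, these stars are the only components; so
  there is no cell of degree 3, and the degree sum gives \<open>n = 4 n\<^sub>4 + 1\<close>.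
  In all, \<open>2 n\<^sub>1 \<le> n + 3\<close>, with equality only for \<open>n \<equiv> 1\<close> modulo 4. This is \<open>tree_leaf_bound\<close>,
  where components are replaced by edge counts: a nonempty set \<open>B\<close> of vertices of a forest spans
  at most \<open>card B - 1\<close> edges, and a connected graph has at least \<open>n - 1\<close> of them. Solving the
  recursion yields \<open>l_squ n = n div 2 + 1\<close>, plus 1 if \<open>n \<equiv> 1\<close> modulo 4, which is exactly
  this bound.

  The bound is attained by a comb, a horizontal row of cells in which every second cell
  carries one arm above and one arm below. Its cells are listed so that every initial segment of
  the list is a tree: each new cell is adjacent to exactly one earlier cell. An arm is attached
  to a cell that is not a leaf, so it adds a leaf; prolonging the row never loses a leaf. Hence
  the number of leaves grows at least as fast as \<open>l_squ\<close>.

  The asymptotic statement follows since \<open>l_squ n\<close> differs from \<open>n / 2\<close> by at most 2.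
\<close>

section \<open>Finite graphs given by a symmetric relation\<close>

text \<open>
  Edges are counted as arcs, that is twice: a tree on \<open>S\<close> has \<open>2 * (card S - 1)\<close> of them. Taking
  the relation \<open>R\<close> on the whole type and the vertex set \<open>S\<close> as separate arguments makes
  it easy to pass to subsets of the vertices.
\<close>

definition induced_graph :: "('a \<times> 'a) set \<Rightarrow> 'a set \<Rightarrow> ('a, 'a \<times> 'a) pre_digraph" where
  "induced_graph R S = with_proj \<lparr> pverts = S, parcs = R \<inter> S \<times> S \<rparr>"

definition nbrs :: "('a \<times> 'a) set \<Rightarrow> 'a set \<Rightarrow> 'a \<Rightarrow> 'a set" where
  "nbrs R S v = {w \<in> S. (v, w) \<in> R}"

lemma induced_graph_simps [simp]:
  "verts (induced_graph R S) = S"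
  "arcs (induced_graph R S) = R \<inter> S \<times> S"
  "tail (induced_graph R S) = fst"
  "head (induced_graph R S) = snd"
  by (simp_all add: induced_graph_def)

lemma finite_nbrs [simp]: "finite S \<Longrightarrow> finite (nbrs R S v)"
  by (simp add: nbrs_def)

lemma out_degree_induced_graph:
  assumes "v \<in> S"
  shows "out_degree (induced_graph R S) v = card (nbrs R S v)"
proof -
  have "out_arcs (induced_graph R S) v = Pair v ` nbrs R S v"
    using assms by (auto simp: out_arcs_def nbrs_def)
  then show ?thesis
    by (simp add: out_degree_def card_image inj_on_def)
qed

lemma leaves_induced_graph:
  "leaves (induced_graph R S) = {v \<in> S. card (nbrs R S v) = 1}"
  by (auto simp: leaves_def out_degree_induced_graph)

lemma connected_induced_graph_iff:
  assumes "sym R"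
  shows "Digraph_Component.connected (induced_graph R S) \<longleftrightarrow>
    S \<noteq> {} \<and> (\<forall>u\<in>S. \<forall>v\<in>S. (u, v) \<in> (R \<inter> S \<times> S)\<^sup>*)"
proof -
  have arcs: "parcs (mk_symmetric (induced_graph R S)) = R \<inter> S \<times> S"
    using assms by (fastforce simp: parcs_mk_symmetric sym_def)
  interpret wf_digraph "with_proj (mk_symmetric (induced_graph R S))"
    by unfold_locales (auto simp: arcs)
  show ?thesis
    by (auto simp: Digraph_Component.connected_def strongly_connected_def reachable_conv arcs)
qed

lemma cycle_induced_graph_iff:
  "pre_digraph.cycle (induced_graph R S) p \<longleftrightarrow>
    (\<exists>u. u \<in> S \<and> set p \<subseteq> R \<inter> S \<times> S \<and> pcas u p u \<and> distinct (tl (pawalk_verts u p)) \<and> p \<noteq> [])"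
  by (simp add: pre_digraph.cycle_def pre_digraph.awalk_def induced_graph_def
      cas_with_proj_eq awalk_verts_with_proj_eq conj_ac)

lemma pawalk_verts_vwalk_arcs:
  "vs \<noteq> [] \<Longrightarrow> pawalk_verts (hd vs) (vwalk_arcs vs) = vs"
  by (induction vs rule: vwalk_arcs.induct) auto

lemma pcas_vwalk_arcs:
  "vs \<noteq> [] \<Longrightarrow> pcas (hd vs) (vwalk_arcs vs) (last vs)"
  by (induction vs rule: vwalk_arcs.induct) auto

text \<open>
  The way from a list of vertices, in which one argues, to the arc lists by which cycles are
  defined.
\<close>

lemma cycle_of_closed_path:
  assumes "distinct vs" "length vs \<ge> 3" "set vs \<subseteq> S"
    and "set (vwalk_arcs vs) \<subseteq> R" "(last vs, hd vs) \<in> R"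
  shows "\<exists>p. pre_digraph.cycle (induced_graph R S) p \<and> length p \<ge> 3"
proof -
  let ?ws = "vs @ [hd vs]"
  let ?p = "vwalk_arcs ?ws"
  have ne: "vs \<noteq> []" using assms(2) by auto
  have len: "length ?p = length vs"
    by (metis vwalk_length_def vwalk_length_simp length_append_singleton diff_Suc_1)
  have arcs: "set ?p \<subseteq> R \<inter> S \<times> S"
    using assms ne arcs_in_vwalk_arcs[of _ ?ws] by (fastforce simp: set_vwalk_arcs_snoc)
  have walk: "pawalk_verts (hd vs) ?p = ?ws" "pcas (hd vs) ?p (hd vs)"
    using pawalk_verts_vwalk_arcs[of ?ws] pcas_vwalk_arcs[of ?ws] ne by auto
  have "distinct (tl ?ws)"
    using assms(1) ne by (cases vs) auto
  then have "pre_digraph.cycle (induced_graph R S) ?p"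
    unfolding cycle_induced_graph_iff using arcs walk ne assms(3) len
    by (intro exI[of _ "hd vs"]) (auto simp del: pawalk_verts.simps)
  then show ?thesis using len assms(2) by (intro exI[of _ ?p]) simp
qed

text \<open>
  The first vertex of a longest path in \<open>B\<close>: all its neighbours lie on the path, and a neighbour
  other than the second vertex would close a cycle of length at least 3. The vertex is
  chosen in a subset \<open>B\<close> of the vertices because the edge count below removes vertices one by one.
\<close>

lemma forest_has_low_degree_vertex:
  assumes acyc: "\<nexists>p. pre_digraph.cycle (induced_graph R S) p \<and> length p \<ge> 3"
    and R: "sym R" "irrefl R"
    and B: "B \<subseteq> S" "finite B" "B \<noteq> {}"
  obtains v where "v \<in> B" "card (nbrs R B v) \<le> 1"
proof -
  define path where
    "path vs \<longleftrightarrow> vs \<noteq> [] \<and> distinct vs \<and> set vs \<subseteq> B \<and> set (vwalk_arcs vs) \<subseteq> R" for vs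
  obtain b where "b \<in> B" using B by blast
  then have "path [b]" by (simp add: path_def)
  moreover have "\<forall>vs. path vs \<longrightarrow> length vs < Suc (card B)"
    unfolding path_def less_Suc_eq_le using B(2) by (metis card_mono distinct_card)
  ultimately have "\<exists>vs. path vs \<and> (\<forall>ws. path ws \<longrightarrow> length ws \<le> length vs)"
    by (rule Lattices_Big.ex_has_greatest_nat)
  then obtain vs where vs: "path vs" and longest: "\<And>ws. path ws \<Longrightarrow> length ws \<le> length vs"
    by auto
  obtain v us where [simp]: "vs = v # us" using vs by (cases vs) (auto simp: path_def)
  have "v \<in> B" using vs by (simp add: path_def)
  have on_path: "w \<in> set us" if "w \<in> nbrs R B v" for w
  proof (rule ccontr)
    assume "w \<notin> set us"
    moreover have "w \<noteq> v" "(w, v) \<in> R" using that R by (auto simp: nbrs_def irrefl_def dest: symD)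
    ultimately have "path (w # vs)"
      using vs that by (auto simp: path_def nbrs_def)
    then show False using longest by fastforce
  qed
  have "w = hd us" if w: "w \<in> nbrs R B v" for w
  proof (rule ccontr)
    assume "w \<noteq> hd us"
    then obtain x ys zs where us: "us = x # ys @ w # zs"
      using on_path[OF w] by (metis hd_append list.exhaust_sel list.sel(1) split_list append_Cons)
    have "set (vwalk_arcs (v # x # ys @ [w])) \<subseteq> R"
      using vs set_vwalk_arcs_append1[of "v # x # ys @ [w]" zs] us by (auto simp: path_def)
    moreover have "(w, v) \<in> R" using w R by (auto simp: nbrs_def dest: symD)
    moreover have "distinct (v # x # ys @ [w])" "set (v # x # ys @ [w]) \<subseteq> S"
      using vs B(1) us by (auto simp: path_def)
    ultimately show False
      using acyc cycle_of_closed_path[of "v # x # ys @ [w]" S R] by simp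
  qed
  then have "nbrs R B v \<subseteq> {hd us}" by blast
  then have "card (nbrs R B v) \<le> card {hd us}" by (rule card_mono[rotated]) simp
  then show ?thesis using that[OF \<open>v \<in> B\<close>] by simp
qed

lemma card_arcs_insert:
  assumes "sym R" "irrefl R" "finite A" "v \<notin> A"
  shows "card (R \<inter> insert v A \<times> insert v A) = card (R \<inter> A \<times> A) + 2 * card (nbrs R A v)"
proof -
  let ?N = "nbrs R A v"
  have eq: "R \<inter> insert v A \<times> insert v A =
      R \<inter> A \<times> A \<union> ({v} \<times> ?N \<union> ?N \<times> {v})"
    using assms by (auto simp: nbrs_def irrefl_def dest: symD)
  have fin: "finite (R \<inter> A \<times> A)" "finite ?N" using assms by auto
  have "card ({v} \<times> ?N \<union> ?N \<times> {v}) = 2 * card ?N"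
    using assms fin by (subst card_Un_disjoint) (auto simp: nbrs_def card_cartesian_product)
  moreover have "(R \<inter> A \<times> A) \<inter> ({v} \<times> ?N \<union> ?N \<times> {v}) = {}"
    using assms(4) by (auto simp: nbrs_def)
  ultimately show ?thesis
    unfolding eq using fin by (subst card_Un_disjoint) auto
qed

lemma forest_card_arcs:
  assumes acyc: "\<nexists>p. pre_digraph.cycle (induced_graph R S) p \<and> length p \<ge> 3"
    and R: "sym R" "irrefl R"
    and B: "finite B" "B \<noteq> {}" "B \<subseteq> S"
  shows "card (R \<inter> B \<times> B) + 2 \<le> 2 * card B"
  using B
proof (induction B rule: finite_psubset_induct)
  case (psubset B)
  obtain v where v: "v \<in> B" "card (nbrs R B v) \<le> 1"
    using forest_has_low_degree_vertex[OF acyc R \<open>B \<subseteq> S\<close> psubset.hyps(1) \<open>B \<noteq> {}\<close>] by blast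
  let ?A = "B - {v}"
  have B_eq: "B = insert v ?A" using v by blast
  have "card (nbrs R ?A v) \<le> card (nbrs R B v)"
    using psubset.hyps(1) by (intro card_mono) (auto simp: nbrs_def)
  then have deg: "card (nbrs R ?A v) \<le> 1" using v(2) by simp
  have arcs: "card (R \<inter> B \<times> B) = card (R \<inter> ?A \<times> ?A) + 2 * card (nbrs R ?A v)"
    using card_arcs_insert[OF R, of ?A v] psubset.hyps(1) unfolding B_eq[symmetric] by simp
  have card: "card B = card ?A + 1"
    using card_Suc_Diff1[OF psubset.hyps(1) v(1)] by simp
  show ?case
  proof (cases "?A = {}")
    case True
    then have "R \<inter> ?A \<times> ?A = {}" "nbrs R ?A v = {}" by (auto simp: nbrs_def)
    then show ?thesis using arcs card by simp
  next
    case False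
    then have "card (R \<inter> ?A \<times> ?A) + 2 \<le> 2 * card ?A"
      using psubset v(1) by blast
    then show ?thesis using arcs card deg by linarith
  qed
qed

lemma rtrancl_leaves_set:
  assumes "(u, v) \<in> r\<^sup>*" "u \<in> A" "v \<notin> A"
  obtains x y where "(x, y) \<in> r" "x \<in> A" "y \<notin> A"
  using assms by (induction rule: rtrancl_induct) blast+

text \<open>
  A subset that is grown from a single vertex along edges that leave it gains at
  least one edge, hence two arcs, with each new vertex.
\<close>

lemma connected_card_arcs:
  assumes conn: "Digraph_Component.connected (induced_graph R S)"
    and R: "sym R" "irrefl R" and fin: "finite S"
  shows "2 * card S \<le> card (R \<inter> S \<times> S) + 2"
proof -
  have reach: "S \<noteq> {}" "\<And>u v. u \<in> S \<Longrightarrow> v \<in> S \<Longrightarrow> (u, v) \<in> (R \<inter> S \<times> S)\<^sup>*"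
    using conn unfolding connected_induced_graph_iff[OF R(1)] by simp_all
  obtain r where "r \<in> S" using reach by blast
  have "Suc k \<le> card S \<Longrightarrow>
      \<exists>A\<subseteq>S. card A = Suc k \<and> 2 * Suc k \<le> card (R \<inter> A \<times> A) + 2" for k
  proof (induction k)
    case 0
    show ?case using \<open>r \<in> S\<close> by (intro exI[of _ "{r}"]) auto
  next
    case (Suc k)
    then obtain A where A: "A \<subseteq> S" "card A = Suc k" "2 * Suc k \<le> card (R \<inter> A \<times> A) + 2"
      by auto
    have "A \<noteq> {}" "A \<noteq> S" using A(2) Suc.prems by auto
    then obtain u v where "u \<in> A" "v \<in> S" "v \<notin> A" using A(1) by blast
    then obtain x y where xy: "(x, y) \<in> R" "x \<in> A" "y \<in> S" "y \<notin> A"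
      using rtrancl_leaves_set[OF reach(2), of u v A] A(1) by blast
    have "finite A" using A(1) fin finite_subset by blast
    have "x \<in> nbrs R A y" using xy R by (auto simp: nbrs_def dest: symD)
    then have "card (nbrs R A y) \<ge> 1"
      using \<open>finite A\<close> by (metis One_nat_def Suc_leI card_gt_0_iff empty_iff finite_nbrs)
    then show ?case
      using A xy \<open>finite A\<close> card_arcs_insert[OF R \<open>finite A\<close> xy(4)]
      by (intro exI[of _ "insert y A"]) auto
  qed
  from this[of "card S - 1"] obtain A where
    "A \<subseteq> S" "card A = card S" "2 * card S \<le> card (R \<inter> A \<times> A) + 2"
    using \<open>r \<in> S\<close> fin by (metis Suc_diff_1 card_gt_0_iff empty_iff le_refl)
  then show ?thesis using fin card_subset_eq by metis
qed

text \<open>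
  On a cycle of length at least 3, the vertex of highest rank would have two distinct neighbours of
  lower rank. This certifies acyclicity of a graph that is built by attaching one leaf
  after the other.
\<close>

lemma acyclic_if_ranked:
  fixes f :: "'a \<Rightarrow> nat"
  assumes inj: "inj_on f S" and "sym R"
    and unique: "\<And>v x y. \<lbrakk>v \<in> S; x \<in> nbrs R S v; y \<in> nbrs R S v; f x < f v; f y < f v\<rbrakk> \<Longrightarrow> x = y"
  shows "\<nexists>p. pre_digraph.cycle (induced_graph R S) p \<and> length p \<ge> 3"
proof
  assume "\<exists>p. pre_digraph.cycle (induced_graph R S) p \<and> length p \<ge> 3"
  then obtain p u where p: "set p \<subseteq> R \<inter> S \<times> S" "pcas u p u" "distinct (tl (pawalk_verts u p))"
    and len: "length p \<ge> 3"
    unfolding cycle_induced_graph_iff by blast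
  define m where "m = length p"
  have chain: "pcas a q b \<Longrightarrow> tl (pawalk_verts a q) = map snd q \<and>
      (q \<noteq> [] \<longrightarrow> fst (q ! 0) = a \<and> snd (last q) = b) \<and>
      (\<forall>i. Suc i < length q \<longrightarrow> fst (q ! Suc i) = snd (q ! i))" for a b and q :: "('a \<times> 'a) list"
  proof (induction q arbitrary: a)
    case (Cons e q)
    have "pawalk_verts (snd e) q = snd e # tl (pawalk_verts (snd e) q)"
      using Cons.prems by (cases q) auto
    then show ?case
      using Cons by (auto simp: nth_Cons split: nat.split)
  qed simp
  \<comment> \<open>The vertices of the cycle, indexed by \<open>0, ..., m - 1\<close>; the neighbours of \<open>b i\<close> have the indices
    \<open>i + 1\<close> and \<open>i - 1\<close> modulo \<open>m\<close>, which differ because \<open>m \<ge> 3\<close>.\<close>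
  define b where "b i = snd (p ! i)" for i
  have dist: "distinct (map snd p)" using p chain by metis
  have b_inj: "b i = b j \<longleftrightarrow> i = j" if "i < m" "j < m" for i j
    using dist that nth_eq_iff_index_eq[of "map snd p" i j] by (simp add: b_def m_def)
  have bS: "b i \<in> S" if "i < m" for i
    using p(1) that nth_mem[of i p] by (fastforce simp: b_def m_def)
  have step: "(b i, b (Suc i)) \<in> R" if "Suc i < m" for i
  proof -
    have "p ! Suc i = (b i, b (Suc i))"
      using chain[OF p(2)] that by (simp add: b_def m_def prod_eq_iff)
    then show ?thesis using p(1) that nth_mem[of "Suc i" p] by (auto simp: m_def)
  qed
  have close: "(b (m - 1), b 0) \<in> R"
  proof -
    have "p \<noteq> []" using len by auto
    then have "p ! 0 = (b (m - 1), b 0)"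
      using chain[OF p(2)] by (simp add: b_def m_def prod_eq_iff last_conv_nth)
    then show ?thesis using \<open>p \<noteq> []\<close> p(1) nth_mem[of 0 p] by auto
  qed
  let ?F = "(\<lambda>j. f (b j)) ` {..<m}"
  have "0 < m" using len unfolding m_def by linarith
  then have F: "finite ?F" "?F \<noteq> {}" by auto
  obtain i where i: "i < m" and max: "Max ?F = f (b i)"
    using Max_in[OF F] by (rule imageE) simp
  have top: "f (b j) \<le> f (b i)" if "j < m" for j
    unfolding max[symmetric] using F(1) that by (intro Max_ge) auto
  have low: "f (b j) < f (b i)" if "j < m" "j \<noteq> i" for j
    using top[OF that(1)] inj b_inj[OF that(1) i] bS that i
    by (metis inj_on_eq_iff le_neq_implies_less)
  define s where "s = (if Suc i = m then 0 else Suc i)"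
  define t where "t = (if i = 0 then m - 1 else i - 1)"
  have st: "s < m" "t < m" "s \<noteq> t" "s \<noteq> i" "t \<noteq> i"
    using i len by (auto simp: s_def t_def m_def)
  have "(b i, b s) \<in> R"
    using close step[of i] i by (auto simp: s_def)
  moreover have "(b t, b i) \<in> R"
    using close step[of "i - 1"] i by (auto simp: t_def)
  ultimately have "b s \<in> nbrs R S (b i)" "b t \<in> nbrs R S (b i)"
    using bS st \<open>sym R\<close> by (auto simp: nbrs_def dest: symD)
  then have "b s = b t"
    using unique[of "b i" "b s" "b t"] low st bS i by blast
  then show False using b_inj st by blast
qed

section \<open>Counting arcs in a tree\<close>

lemma card_arcs_eq_sum_degrees:
  assumes "finite S"
  shows "card (R \<inter> S \<times> S) = (\<Sum>v\<in>S. card (nbrs R S v))"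
proof -
  have "R \<inter> S \<times> S = (SIGMA v:S. nbrs R S v)" by (auto simp: nbrs_def)
  then show ?thesis using assms by simp
qed

text \<open>
  The counting argument for the upper bound. It applies to all trees of maximum degree 4 in
  which the neighbours of vertices of degree 4 have degree at most 2; without that restriction,
  the number of leaves can approach two thirds of the number of vertices.
\<close>

lemma tree_leaf_bound:
  assumes tree: "graph_tree (induced_graph R S)"
    and R: "sym R" "irrefl R" and fin: "finite S" and two: "card S \<ge> 2"
    and deg4: "\<And>v. v \<in> S \<Longrightarrow> card (nbrs R S v) \<le> 4"
    and sep: "\<And>v w. \<lbrakk>v \<in> S; w \<in> nbrs R S v; card (nbrs R S v) = 4\<rbrakk> \<Longrightarrow> card (nbrs R S w) \<le> 2"
  shows "2 * num_leaves (induced_graph R S) \<le> card S + 3"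
    and "2 * num_leaves (induced_graph R S) = card S + 3 \<Longrightarrow> card S mod 4 = 1"
proof -
  define d where "d v = card (nbrs R S v)" for v
  define V where "V k = {v \<in> S. d v = k}" for k
  \<comment> \<open>Deleting \<open>V 2\<close> leaves the stars formed by \<open>V 4\<close> and \<open>X\<close>, and the forest induced on \<open>B\<close>.\<close>
  define X where "X = {v \<in> V 1. \<exists>w\<in>V 4. w \<in> nbrs R S v}"
  define B where "B = (V 1 - X) \<union> V 3"
  let ?E = "R \<inter> S \<times> S"
  have acyc: "\<nexists>p. pre_digraph.cycle (induced_graph R S) p \<and> length p \<ge> 3"
    and conn: "Digraph_Component.connected (induced_graph R S)"
    using tree by (auto simp: graph_tree_def)
  have finV [simp]: "finite (V k)" for k using fin by (simp add: V_def)
  have d_pos: "d v \<ge> 1" if v: "v \<in> S" for v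
  proof -
    have "S \<noteq> {v}" using two by auto
    then obtain w where "w \<in> S" "w \<noteq> v" using v by blast
    then have "(v, w) \<in> ?E\<^sup>*"
      using conn v unfolding connected_induced_graph_iff[OF R(1)] by simp
    then obtain y where "(v, y) \<in> ?E" using \<open>w \<noteq> v\<close> by (metis converse_rtranclE)
    then have "nbrs R S v \<noteq> {}" by (auto simp: nbrs_def)
    then show ?thesis using fin by (simp add: d_def Suc_le_eq card_gt_0_iff)
  qed
  have S_eq: "S = V 1 \<union> V 2 \<union> V 3 \<union> V 4"
    using d_pos deg4 by (fastforce simp: V_def d_def)
  have sum_split: "(\<Sum>v\<in>S. g v) = sum g (V 1) + sum g (V 2) + sum g (V 3) + sum g (V 4)"
    for g :: "'a \<Rightarrow> nat"
    by (subst S_eq, (subst sum.union_disjoint; (auto simp: V_def fin)?)+)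
  have size: "card S = card (V 1) + card (V 2) + card (V 3) + card (V 4)"
    using sum_split[of "\<lambda>_. 1"] by simp
  have sumV: "sum d (V k) = k * card (V k)" for k by (simp add: V_def)
  have degsum: "card ?E = card (V 1) + 2 * card (V 2) + 3 * card (V 3) + 4 * card (V 4)"
    using card_arcs_eq_sum_degrees[OF fin] sum_split[of d] sumV by (simp add: d_def)
  have edges: "card ?E + 2 = 2 * card S"
    using connected_card_arcs[OF conn R fin] forest_card_arcs[OF acyc R fin] two by force
  have X: "X \<subseteq> V 1" by (auto simp: X_def)
  have finX [simp]: "finite X" using X finV finite_subset by blast
  have finB [simp]: "finite B" by (simp add: B_def)
  have BS: "B \<subseteq> S" by (auto simp: B_def V_def)
  have "card (V 1 - X) + card X = card (V 1)"
    using X by (metis card_Diff_subset card_mono finV finX le_add_diff_inverse2)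
  moreover have "card B = card (V 1 - X) + card (V 3)"
    unfolding B_def by (subst card_Un_disjoint) (auto simp: V_def fin)
  ultimately have cardB: "card B + card X = card (V 1) + card (V 3)" by simp
  let ?star = "\<lambda>A. SIGMA v:A. nbrs R S v"
  have star: "card (?star (V 2)) = 2 * card (V 2)" "card (?star X) = card X"
  proof -
    show "card (?star (V 2)) = 2 * card (V 2)" using sumV[of 2] fin by (simp add: d_def)
    have "sum d X = (\<Sum>v\<in>X. 1)" using X by (intro sum.cong) (auto simp: V_def)
    then show "card (?star X) = card X" using fin by (simp add: d_def)
  qed
  have far: "w \<in> V 2 \<union> X" if "v \<in> V 4" "w \<in> nbrs R S v" for v w
  proof -
    have "w \<in> S" "v \<in> nbrs R S w" using that R by (auto simp: nbrs_def V_def dest: symD)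
    then have "d w \<in> {1, 2}" using sep[of v w] that d_pos[of w] by (auto simp: V_def d_def)
    then show ?thesis using \<open>w \<in> S\<close> \<open>v \<in> nbrs R S w\<close> that by (auto simp: V_def X_def)
  qed
  have part: "S = V 4 \<union> V 2 \<union> X \<union> B" using S_eq X by (auto simp: B_def)
  \<comment> \<open>An arc that avoids \<open>V 2\<close> and \<open>X\<close> cannot touch \<open>V 4\<close>, so it runs inside \<open>B\<close>.\<close>
  have cover: "?E \<subseteq> (?star (V 2) \<union> (?star (V 2))\<inverse>) \<union> (?star X \<union> (?star X)\<inverse>) \<union> (R \<inter> B \<times> B)"
  proof
    fix e assume e: "e \<in> ?E"
    obtain v w where [simp]: "e = (v, w)" by (cases e)
    have vw: "v \<in> S" "w \<in> S" "w \<in> nbrs R S v" "v \<in> nbrs R S w"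
      using e R by (auto simp: nbrs_def dest: symD)
    show "e \<in> (?star (V 2) \<union> (?star (V 2))\<inverse>) \<union> (?star X \<union> (?star X)\<inverse>) \<union> (R \<inter> B \<times> B)"
      using vw e far[of v w] far[of w v] part by auto
  qed
  have sym_card: "card (A \<union> A\<inverse>) \<le> 2 * card A" for A :: "('a \<times> 'a) set"
    using card_Un_le[of A "A\<inverse>"] by simp
  have fin_star: "finite (?star (V 2))" "finite (?star X)" using fin by auto
  have "card ?E \<le> card ((?star (V 2) \<union> (?star (V 2))\<inverse>) \<union> (?star X \<union> (?star X)\<inverse>) \<union> (R \<inter> B \<times> B))"
    using fin_star by (intro card_mono cover) auto
  also have "\<dots> \<le> card (?star (V 2) \<union> (?star (V 2))\<inverse>) + card (?star X \<union> (?star X)\<inverse>) + card (R \<inter> B \<times> B)"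
    by (meson add_le_mono card_Un_le le_refl order_trans)
  finally have count: "card ?E \<le> 4 * card (V 2) + 2 * card X + card (R \<inter> B \<times> B)"
    using sym_card[of "?star (V 2)"] sym_card[of "?star X"] star by linarith
  \<comment> \<open>A nonempty \<open>B\<close> contributes at least one component and thus improves the bound by one.\<close>
  have few4: "card (V 4) + (if B = {} then 0 else 1) \<le> card (V 2) + 1"
  proof (cases "B = {}")
    case True
    then show ?thesis using count edges size cardB by simp
  next
    case False
    then show ?thesis
      using forest_card_arcs[OF acyc R finB False BS] count edges size cardB by simp
  qed
  have nl: "num_leaves (induced_graph R S) = card (V 1)"
    by (simp add: num_leaves_def leaves_induced_graph V_def d_def)
  have main: "2 * card (V 1) + card (V 2) = card S + 2 + card (V 4)"
    using degsum edges size by linarith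
  show "2 * num_leaves (induced_graph R S) \<le> card S + 3"
    using main few4 nl by (auto split: if_splits)
  assume "2 * num_leaves (induced_graph R S) = card S + 3"
  then have "card (V 4) = card (V 2) + 1" using main nl by linarith
  then have "B = {}" using few4 by (auto split: if_splits)
  then have "card (V 3) = 0" by (simp add: B_def)
  then have "card S = 4 * card (V 4) + 1"
    using degsum edges size \<open>card (V 4) = card (V 2) + 1\<close> by linarith
  then show "card S mod 4 = 1" by simp
qed

section \<open>Polyominoes\<close>

definition adj :: "((int \<times> int) \<times> (int \<times> int)) set" where
  "adj = {((a, b), (c, d)). \<bar>a - c\<bar> + \<bar>b - d\<bar> = 1}"

lemma sum_squares_eq_1_iff:
  fixes x y :: int
  shows "x\<^sup>2 + y\<^sup>2 = 1 \<longleftrightarrow> \<bar>x\<bar> + \<bar>y\<bar> = 1"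
proof
  assume *: "x\<^sup>2 + y\<^sup>2 = 1"
  have "x\<^sup>2 \<le> 1\<^sup>2" "y\<^sup>2 \<le> 1\<^sup>2"
    using * zero_le_power2[of x] zero_le_power2[of y] unfolding one_power2 by linarith+
  then have "\<bar>x\<bar> \<le> 1" "\<bar>y\<bar> \<le> 1" by (simp_all add: abs_square_le_1)
  then have "x \<in> {-1, 0, 1}" "y \<in> {-1, 0, 1}" by auto
  then show "\<bar>x\<bar> + \<bar>y\<bar> = 1" using * by auto
next
  assume *: "\<bar>x\<bar> + \<bar>y\<bar> = 1"
  then have "x \<in> {-1, 0, 1}" "y \<in> {-1, 0, 1}" by auto
  then show "x\<^sup>2 + y\<^sup>2 = 1" using * by auto
qed

lemma parcs_square_lattice: "parcs square_lattice = adj"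
proof -
  have "dist (real_point (a, b)) (real_point (c, d)) = 1 \<longleftrightarrow> \<bar>a - c\<bar> + \<bar>b - d\<bar> = 1" for a b c d
  proof -
    have "dist (real_point (a, b)) (real_point (c, d)) = 1 \<longleftrightarrow>
        (real_of_int a - real_of_int c)\<^sup>2 + (real_of_int b - real_of_int d)\<^sup>2 = 1"
      by (simp add: real_point_def dist_prod_def dist_real_def)
    also have "\<dots> \<longleftrightarrow> real_of_int ((a - c)\<^sup>2 + (b - d)\<^sup>2) = real_of_int 1" by simp
    also have "\<dots> \<longleftrightarrow> (a - c)\<^sup>2 + (b - d)\<^sup>2 = 1" by (rule of_int_eq_iff)
    finally show ?thesis by (simp add: sum_squares_eq_1_iff)
  qed
  then show ?thesis by (auto simp: square_lattice_def adj_def)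
qed

lemma sym_adj: "sym adj" and irrefl_adj: "irrefl adj"
  by (auto simp: adj_def sym_def irrefl_def)

lemma induced_subgraph_of_square_lattice:
  "induced_subgraph (induced_graph adj S) (with_proj square_lattice)"
proof -
  have "wf_digraph (induced_graph adj S)" by unfold_locales auto
  moreover have "wf_digraph (with_proj square_lattice)"
    by unfold_locales (auto simp: square_lattice_def)
  moreover have "pverts square_lattice = UNIV" by (simp add: square_lattice_def)
  ultimately show ?thesis
    by (auto simp: induced_subgraph_def subgraph_def compatible_def parcs_square_lattice)
qed

lemma induced_subgraph_of_square_latticeD:
  assumes "induced_subgraph T (with_proj square_lattice)"
  shows "T = induced_graph adj (verts T)"
proof -
  have arcs: "arcs T = {e \<in> adj. fst e \<in> verts T \<and> snd e \<in> verts T}"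
    using assms unfolding induced_subgraph_def with_proj_simps parcs_square_lattice
    by (rule conjunct2)
  have comp: "compatible (with_proj square_lattice) T"
    using assms unfolding induced_subgraph_def subgraph_def by blast
  show ?thesis
  proof (rule pre_digraph.equality)
    show "arcs T = arcs (induced_graph adj (verts T))"
      unfolding arcs induced_graph_simps by auto
    show "tail T = tail (induced_graph adj (verts T))"
      "head T = head (induced_graph adj (verts T))"
      using compatible_tail[OF comp] compatible_head[OF comp] by simp_all
  qed simp_all
qed

lemma tree_like_polyomino_iff:
  "tree_like_polyomino n T \<longleftrightarrow>
    (\<exists>S. T = induced_graph adj S \<and> finite S \<and> card S = n \<and> graph_tree (induced_graph adj S))"
proof
  assume *: "tree_like_polyomino n T"
  then have "T = induced_graph adj (verts T)"
    by (intro induced_subgraph_of_square_latticeD) (simp add: tree_like_polyomino_def)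
  moreover have "finite (verts T)" "card (verts T) = n" "graph_tree T"
    using * by (simp_all add: tree_like_polyomino_def)
  ultimately show "\<exists>S. T = induced_graph adj S \<and> finite S \<and> card S = n \<and>
      graph_tree (induced_graph adj S)"
    by metis
next
  assume "\<exists>S. T = induced_graph adj S \<and> finite S \<and> card S = n \<and>
      graph_tree (induced_graph adj S)"
  then show "tree_like_polyomino n T"
    by (auto simp: tree_like_polyomino_def induced_subgraph_of_square_lattice)
qed

lemma adj_iff:
  "((a, b), c) \<in> adj \<longleftrightarrow> c \<in> {(a + 1, b), (a - 1, b), (a, b + 1), (a, b - 1)}"
  by (cases c) (auto simp: adj_def)

lemma nbrs_adj:
  "nbrs adj S (a, b) = S \<inter> {(a + 1, b), (a - 1, b), (a, b + 1), (a, b - 1)}"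
  unfolding nbrs_def adj_iff by blast

text \<open>
  The signs \<open>s\<close> and \<open>t\<close> select one of the four unit squares with corner \<open>(a, b)\<close>.
\<close>

lemma no_square_in_tree:
  assumes "graph_tree (induced_graph adj S)" and [simp]: "\<bar>s\<bar> = 1" "\<bar>t\<bar> = 1"
  shows "\<not> {(a, b), (a + s, b), (a + s, b + t), (a, b + t)} \<subseteq> S"
proof
  assume *: "{(a, b), (a + s, b), (a + s, b + t), (a, b + t)} \<subseteq> S"
  have "s \<noteq> 0" "t \<noteq> 0" using assms(2,3) by (metis abs_0 zero_neq_one)+
  then have "\<exists>p. pre_digraph.cycle (induced_graph adj S) p \<and> length p \<ge> 3"
    using * by (intro cycle_of_closed_path[of "[(a, b), (a + s, b), (a + s, b + t), (a, b + t)]"])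
      (auto simp: adj_def)
  then show False using assms(1) by (simp add: graph_tree_def)
qed

text \<open>
  If all four neighbours of \<open>v\<close> are present, the four cells diagonal to \<open>v\<close> are absent, as each
  of them would complete a square. So \<open>w\<close> can only be adjacent to \<open>v\<close> and to the cell opposite to
  \<open>v\<close>.
\<close>

lemma nbrs_of_degree_4_cell:
  assumes tree: "graph_tree (induced_graph adj S)"
    and "v \<in> S" and w: "w \<in> nbrs adj S v" and v: "card (nbrs adj S v) = 4"
  shows "card (nbrs adj S w) \<le> 2"
proof -
  obtain a b where [simp]: "v = (a, b)" by (cases v)
  let ?N = "{(a + 1, b), (a - 1, b), (a, b + 1), (a, b - 1)}"
  have "card ?N = 4" by simp
  then have "nbrs adj S v = ?N"
    using v card_subset_eq[of ?N "nbrs adj S v"] by (auto simp: nbrs_adj)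
  then have N: "?N \<subseteq> S" "w \<in> ?N" using w by (auto simp: nbrs_def)
  have corner: "(a + s, b + t) \<notin> S" if "\<bar>s\<bar> = 1" "\<bar>t\<bar> = 1" for s t
  proof -
    have "s \<in> {1, -1}" "t \<in> {1, -1}" using that by auto
    then have "(a + s, b) \<in> S" "(a, b + t) \<in> S" using N(1) by auto
    then show ?thesis using no_square_in_tree[OF tree that, of a b] \<open>v \<in> S\<close> by auto
  qed
  have corners: "(a + 1, b + 1) \<notin> S" "(a + 1, b - 1) \<notin> S" "(a - 1, b + 1) \<notin> S" "(a - 1, b - 1) \<notin> S"
    using corner[of 1 1] corner[of 1 "-1"] corner[of "-1" 1] corner[of "-1" "-1"] by simp_all
  obtain x y where [simp]: "w = (x, y)" by (cases w)
  \<comment> \<open>The second cell is the reflection of \<open>v\<close> in \<open>w\<close>.\<close>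
  have "nbrs adj S w \<subseteq> {v, (2 * x - a, 2 * y - b)}"
    using N(2) corners by (auto simp: nbrs_adj algebra_simps)
  then have "card (nbrs adj S w) \<le> card {v, (2 * x - a, 2 * y - b)}"
    by (rule card_mono[rotated]) simp
  also have "\<dots> \<le> 2" by (simp add: card_insert_if)
  finally show ?thesis .
qed

lemma card_nbrs_adj_le: "card (nbrs adj S v) \<le> 4"
proof -
  obtain a b where [simp]: "v = (a, b)" by (cases v)
  have "card (nbrs adj S v) \<le> card {(a + 1, b), (a - 1, b), (a, b + 1), (a, b - 1)}"
    by (intro card_mono) (auto simp: nbrs_adj)
  then show ?thesis by simp
qed

lemma l_squ_closed_form:
  "n \<ge> 2 \<Longrightarrow> l_squ n = n div 2 + 1 + (if n mod 4 = 1 then 1 else 0)"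
proof (induction n rule: less_induct)
  case (less n)
  show ?case
  proof (cases "n \<le> 5")
    case True
    then have "n \<in> {2, 3, 4, 5}" using less.prems by auto
    moreover have "l_squ 2 = 2" "l_squ 3 = 2" "l_squ 4 = 3" "l_squ 5 = 4"
      by (simp_all add: l_squ.simps)
    ultimately show ?thesis by auto
  next
    case False
    define m where "m = n - 4"
    have m: "n = m + 4" "m \<ge> 2" using False by (auto simp: m_def)
    have "l_squ n = l_squ m + 2" using False m by (subst l_squ.simps) simp
    then show ?thesis using less.IH[of m] m by auto
  qed
qed

lemma num_leaves_le_l_squ:
  assumes "n \<ge> 2" "tree_like_polyomino n T"
  shows "num_leaves T \<le> l_squ n"
proof -
  obtain S where S: "T = induced_graph adj S" "finite S" "card S = n"
    "graph_tree (induced_graph adj S)"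
    using assms(2) tree_like_polyomino_iff by blast
  have bound: "2 * num_leaves T \<le> n + 3"
    and sharp: "2 * num_leaves T = n + 3 \<Longrightarrow> n mod 4 = 1"
    using tree_leaf_bound[OF S(4) sym_adj irrefl_adj S(2) _ card_nbrs_adj_le
        nbrs_of_degree_4_cell[OF S(4)]] S(1,3) assms(1) by simp_all
  show ?thesis
  proof (cases "n mod 4 = 1")
    case True
    then show ?thesis using bound unfolding l_squ_closed_form[OF assms(1)] by simp
  next
    case False
    then have "2 * num_leaves T \<le> n + 2" using bound sharp by linarith
    then show ?thesis using False unfolding l_squ_closed_form[OF assms(1)] by simp
  qed
qed

section \<open>A comb with many leaves\<close>

text \<open>
  The row occupies the cells \<open>(x, 0)\<close> with \<open>x \<ge> 0\<close>, and the arms sit above and below the cells with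
  odd \<open>x\<close>. The order matters: both arms of \<open>(2k + 1, 0)\<close> come right after \<open>(2k + 2, 0)\<close>, so that an
  arm never grows out of the end of the row, which would cost the leaf there.
\<close>

definition comb_cell :: "nat \<Rightarrow> int \<times> int" where
  "comb_cell i =
    (let k = int (i div 4) in
     if i = 0 then (0, 0)
     else if i mod 4 = 0 then (2 * k - 1, -1)
     else if i mod 4 = 1 then (2 * k + 1, 0)
     else if i mod 4 = 2 then (2 * k + 2, 0)
     else (2 * k + 1, 1))"

lemma div_mod_4:
  "Suc (4 * k) div 4 = k" "Suc (Suc (4 * k)) div 4 = k" "Suc (Suc (4 * k)) mod 4 = 2"
  by presburger+

lemma comb_cell_simps:
  "comb_cell 0 = (0, 0)"
  "comb_cell (4 * k + 1) = (2 * int k + 1, 0)"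
  "comb_cell (4 * k + 2) = (2 * int k + 2, 0)"
  "comb_cell (4 * k + 3) = (2 * int k + 1, 1)"
  "comb_cell (4 * k + 4) = (2 * int k + 1, -1)"
  by (simp_all add: comb_cell_def div_mod_4)

lemma comb_index_cases:
  obtains "i = 0" | k where "i = 4 * k + 1" | k where "i = 4 * k + 2"
  | k where "i = 4 * k + 3" | k where "i = 4 * k + (4::nat)"
proof -
  have "i = 0 \<or> (\<exists>k. i = 4 * k + 1 \<or> i = 4 * k + 2 \<or> i = 4 * k + 3 \<or> i = 4 * k + 4)" by presburger
  then show ?thesis using that by blast
qed

text \<open>
  A left inverse of \<open>comb_cell\<close>. Having the position as an explicit function of the cell turns
  the question which cells precede a given one into linear arithmetic over its four neighbours.
\<close>

definition comb_index :: "int \<times> int \<Rightarrow> int" where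
  "comb_index c =
    (case c of (x, y) \<Rightarrow>
      if y = 0 then (if x = 0 then 0 else if even x then 2 * x - 2 else 2 * x - 1)
      else if y = 1 then 2 * x + 1 else 2 * x + 2)"

lemma comb_index_comb_cell: "comb_index (comb_cell i) = int i"
  by (cases i rule: comb_index_cases; simp only: comb_cell_simps; simp add: comb_index_def)

lemma comb_cell_eq_iff: "comb_cell i = comb_cell j \<longleftrightarrow> i = j"
  by (metis comb_index_comb_cell of_nat_eq_iff)

lemma odd_comb_cell: "comb_cell i = (x, y) \<Longrightarrow> y \<noteq> 0 \<Longrightarrow> odd x"
  by (cases i rule: comb_index_cases; simp only: comb_cell_simps; auto)

text \<open>
  The position of the earlier neighbour. For the cell \<open>(2k + 1, 0)\<close> at position \<open>4k + 1\<close> this is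
  the previous cell of the row; if \<open>k > 0\<close>, it is three positions earlier because the arms
  of \<open>(2k - 1, 0)\<close> come in between. The next three cells are all attached to \<open>(2k + 1, 0)\<close>.
\<close>

definition comb_parent :: "nat \<Rightarrow> nat" where
  "comb_parent i =
    (if i \<le> 1 then 0 else if i mod 4 = 1 then i - 3 else 4 * ((i - 1) div 4) + 1)"

lemma comb_parent_simps:
  "comb_parent (4 * k + 1) = (if k = 0 then 0 else 4 * k - 2)"
  "comb_parent (4 * k + 2) = 4 * k + 1"
  "comb_parent (4 * k + 3) = 4 * k + 1"
  "comb_parent (4 * k + 4) = 4 * k + 1"
  by (simp_all add: comb_parent_def div_mod_4)

lemma comb_cell_adj_parent:
  "i > 0 \<Longrightarrow> (comb_cell i, comb_cell (comb_parent i)) \<in> adj"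
proof (cases i rule: comb_index_cases)
  case (2 k)
  then show ?thesis
  proof (cases k)
    case (Suc m)
    then have "comb_parent i = 4 * m + 2" using 2 comb_parent_simps(1)[of k] by simp
    then show ?thesis using Suc unfolding 2 by (simp only: comb_cell_simps) (simp add: adj_def)
  qed (simp add: adj_def comb_cell_def comb_parent_def)
qed (simp_all only: comb_cell_simps comb_parent_simps, simp_all add: adj_def)

lemma comb_parent_unique:
  assumes "j < i" "(comb_cell i, comb_cell j) \<in> adj"
  shows "j = comb_parent i"
proof -
  obtain x y where c: "comb_cell j = (x, y)" by fastforce
  have j: "int j = comb_index (x, y)" using comb_index_comb_cell[of j] c by simp
  \<comment> \<open>Off the row, \<open>comb_index\<close> is meaningful only for odd \<open>x\<close>.\<close>
  have o: "y \<noteq> 0 \<Longrightarrow> odd x" using odd_comb_cell[OF c] .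
  show ?thesis
    using assms(2) unfolding c
    by (cases i rule: comb_index_cases; simp only: comb_cell_simps comb_parent_simps adj_iff)
      (use assms(1) j o in \<open>auto simp: comb_index_def split: if_splits\<close>)
qed

lemma comb_parent_less: "i > 0 \<Longrightarrow> comb_parent i < i"
  by (cases i rule: comb_index_cases; simp only: comb_parent_simps) auto

definition comb :: "nat \<Rightarrow> (int \<times> int) set" where
  "comb n = comb_cell ` {..<n}"

lemma finite_comb [simp]: "finite (comb n)"
  and card_comb [simp]: "card (comb n) = n"
  and comb_Suc: "comb (Suc n) = insert (comb_cell n) (comb n)"
  and comb_cell_in_comb_iff: "comb_cell i \<in> comb n \<longleftrightarrow> i < n"
  by (auto simp: comb_def card_image inj_on_def comb_cell_eq_iff lessThan_Suc)

lemma nbrs_new_comb_cell: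
  assumes "n > 0"
  shows "nbrs adj (comb n) (comb_cell n) = {comb_cell (comb_parent n)}"
proof -
  have "comb_cell (comb_parent n) \<in> nbrs adj (comb n) (comb_cell n)"
    using comb_parent_less[OF assms] comb_cell_adj_parent[OF assms]
    by (simp add: nbrs_def comb_cell_in_comb_iff)
  moreover have "c = comb_cell (comb_parent n)" if c: "c \<in> nbrs adj (comb n) (comb_cell n)" for c
  proof -
    obtain j where "j < n" "c = comb_cell j" "(comb_cell n, comb_cell j) \<in> adj"
      using c unfolding nbrs_def comb_def by blast
    then show ?thesis using comb_parent_unique by blast
  qed
  ultimately show ?thesis by blast
qed

text \<open>
  Connected because iterating \<open>comb_parent\<close> leads to position 0, acyclic because the parent is
  the only earlier neighbour.
\<close>

lemma comb_tree:
  assumes "n > 0"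
  shows "graph_tree (induced_graph adj (comb n))"
  unfolding graph_tree_def
proof
  let ?E = "adj \<inter> comb n \<times> comb n"
  have from_root: "i < n \<Longrightarrow> (comb_cell 0, comb_cell i) \<in> ?E\<^sup>*" for i
  proof (induction i rule: less_induct)
    case (less i)
    show ?case
    proof (cases "i = 0")
      case False
      then have parent: "comb_parent i < i" "(comb_cell i, comb_cell (comb_parent i)) \<in> adj"
        using comb_parent_less comb_cell_adj_parent by auto
      then have "(comb_cell (comb_parent i), comb_cell i) \<in> ?E"
        using less.prems sym_adj by (auto simp: comb_cell_in_comb_iff dest: symD)
      moreover have "(comb_cell 0, comb_cell (comb_parent i)) \<in> ?E\<^sup>*"
        using less parent by simp
      ultimately show ?thesis by (rule rtrancl.rtrancl_into_rtrancl[rotated])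
    qed simp
  qed
  have "sym (?E\<^sup>*)" using sym_adj by (intro sym_rtrancl) (auto simp: sym_def)
  then have "(u, v) \<in> ?E\<^sup>*" if "u \<in> comb n" "v \<in> comb n" for u v
    using from_root that unfolding comb_def by (blast dest: symD intro: rtrancl_trans)
  moreover have "comb n \<noteq> {}" using assms by (auto simp: comb_def)
  ultimately show "Digraph_Component.connected (induced_graph adj (comb n))"
    unfolding connected_induced_graph_iff[OF sym_adj] by blast
  show "\<nexists>p. pre_digraph.cycle (induced_graph adj (comb n)) p \<and> length p \<ge> 3"
  proof (rule acyclic_if_ranked)
    let ?f = "\<lambda>c. nat (comb_index c)"
    have f: "?f (comb_cell i) = i" for i by (simp add: comb_index_comb_cell)
    show "inj_on ?f (comb n)" by (auto simp: inj_on_def comb_def f)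
    show "sym adj" by (rule sym_adj)
    fix v x y
    assume "v \<in> comb n" "x \<in> nbrs adj (comb n) v" "y \<in> nbrs adj (comb n) v"
      "?f x < ?f v" "?f y < ?f v"
    then obtain i j k where "v = comb_cell i" "x = comb_cell j" "y = comb_cell k"
      "(comb_cell i, comb_cell j) \<in> adj" "(comb_cell i, comb_cell k) \<in> adj" "j < i" "k < i"
      by (auto simp: nbrs_def comb_def comb_index_comb_cell)
    then show "x = y" using comb_parent_unique by metis
  qed
qed

text \<open>
  The new vertex is a leaf, and only its neighbour \<open>p\<close> can stop being one.
\<close>

lemma num_leaves_attach:
  assumes R: "sym R" "irrefl R" and fin: "finite S" and w: "w \<notin> S" "nbrs R S w = {p}"
  shows "num_leaves (induced_graph R S) + (if p \<in> leaves (induced_graph R S) then 0 else 1)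
    \<le> num_leaves (induced_graph R (insert w S))"
proof -
  let ?L = "leaves (induced_graph R S)"
  have "nbrs R (insert w S) w = {p}"
    using w R by (auto simp: nbrs_def irrefl_def)
  moreover have "nbrs R (insert w S) v = nbrs R S v" if "v \<in> S" "v \<noteq> p" for v
    using w that R(1) by (auto simp: nbrs_def dest: symD)
  ultimately have sub: "insert w (?L - {p}) \<subseteq> leaves (induced_graph R (insert w S))"
    by (auto simp: leaves_induced_graph)
  have finL: "finite ?L" "w \<notin> ?L" using fin w by (auto simp: leaves_induced_graph)
  have "card (insert w (?L - {p})) \<le> num_leaves (induced_graph R (insert w S))"
    unfolding num_leaves_def using fin by (intro card_mono sub) (simp add: leaves_induced_graph)
  moreover have "card (insert w (?L - {p})) = card (?L - {p}) + 1"
    using finL by simp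
  moreover have "card (?L - {p}) + (if p \<in> ?L then 1 else 0) = card ?L"
    using finL card_Suc_Diff1[of ?L p] by auto
  ultimately show ?thesis by (auto simp: num_leaves_def split: if_splits)
qed

text \<open>
  When its arms are added, the cell \<open>(2k + 1, 0)\<close> already has both neighbours in the row.
\<close>

lemma arm_base_not_leaf:
  assumes "4 * k + 2 < n"
  shows "comb_cell (4 * k + 1) \<notin> leaves (induced_graph adj (comb n))"
proof
  let ?i = "4 * k + 1"
  assume "comb_cell ?i \<in> leaves (induced_graph adj (comb n))"
  then have one: "card (nbrs adj (comb n) (comb_cell ?i)) = 1"
    by (simp add: leaves_induced_graph)
  have less: "comb_parent ?i < ?i" by (rule comb_parent_less) simp
  have "(comb_cell ?i, comb_cell (comb_parent ?i)) \<in> adj"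
    by (rule comb_cell_adj_parent) simp
  moreover have "(comb_cell ?i, comb_cell (4 * k + 2)) \<in> adj"
    unfolding comb_cell_simps by (simp add: adj_def)
  ultimately have "comb_cell (comb_parent ?i) \<in> nbrs adj (comb n) (comb_cell ?i)"
    "comb_cell (4 * k + 2) \<in> nbrs adj (comb n) (comb_cell ?i)"
    using less assms by (auto simp: nbrs_def comb_cell_in_comb_iff)
  then have "comb_cell (comb_parent ?i) = comb_cell (4 * k + 2)"
    using one by (metis card_1_singletonE singletonD)
  then show False using less by (simp add: comb_cell_eq_iff)
qed

text \<open>
  The closed form of \<open>l_squ\<close> increases by one from \<open>n\<close> to \<open>n + 1\<close> exactly if \<open>n\<close> is 0 or 3
  modulo 4, and these are the positions of the arms.
\<close>

lemma l_squ_le_num_leaves_comb: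
  "n \<ge> 2 \<Longrightarrow> l_squ n \<le> num_leaves (induced_graph adj (comb n))"
proof (induction n rule: nat_induct_at_least)
  case base
  have "comb 2 = {(0, 0), (1, 0)}"
    using comb_cell_simps(2)[of 0]
    by (auto simp: comb_def comb_cell_simps(1) numeral_2_eq_2 lessThan_Suc)
  moreover have "nbrs adj {(0, 0), (1, 0)} (0, 0) = {(1, 0)}"
    "nbrs adj {(0, 0), (1, 0)} (1, 0) = {(0, 0)}"
    unfolding nbrs_adj by auto
  ultimately have "leaves (induced_graph adj (comb 2)) = {(0, 0), (1, 0)}"
    by (auto simp: leaves_induced_graph)
  then show ?case by (simp add: num_leaves_def l_squ.simps)
next
  case (Suc n)
  have "comb_cell n \<notin> comb n" by (simp add: comb_cell_in_comb_iff)
  then have grow: "num_leaves (induced_graph adj (comb n)) +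
      (if comb_cell (comb_parent n) \<in> leaves (induced_graph adj (comb n)) then 0 else 1)
      \<le> num_leaves (induced_graph adj (comb (Suc n)))"
    unfolding comb_Suc using Suc.hyps
    by (intro num_leaves_attach sym_adj irrefl_adj nbrs_new_comb_cell) auto
  have closed: "l_squ n = n div 2 + 1 + (if n mod 4 = 1 then 1 else 0)"
    "l_squ (Suc n) = Suc n div 2 + 1 + (if Suc n mod 4 = 1 then 1 else 0)"
    using l_squ_closed_form[of n] l_squ_closed_form[of "Suc n"] Suc.hyps by simp_all
  show ?case
  proof (cases "n mod 4 = 3 \<or> n mod 4 = 0")
    case True
    have "\<exists>k. n = 4 * k + 3 \<or> n = 4 * k + 4" using True Suc.hyps by presburger
    then obtain k where k: "n = 4 * k + 3 \<or> n = 4 * k + 4" by blast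
    then have "comb_parent n = 4 * k + 1" by (auto simp only: comb_parent_simps)
    moreover have "4 * k + 2 < n" using k by linarith
    ultimately have "comb_cell (comb_parent n) \<notin> leaves (induced_graph adj (comb n))"
      using arm_base_not_leaf by metis
    then have "l_squ n + 1 \<le> num_leaves (induced_graph adj (comb (Suc n)))"
      using grow Suc.IH by simp
    moreover have "l_squ (Suc n) \<le> l_squ n + 1"
      unfolding closed using True by (simp only: split: if_split) presburger
    ultimately show ?thesis by linarith
  next
    case False
    have "Suc n div 2 \<le> n div 2 + (if n mod 4 = 1 then 1 else 0)"
    proof (cases "n mod 4 = 1")
      case neq: False
      then have "even n" using False by presburger
      then show ?thesis by simp
    qed simp
    moreover have "Suc n mod 4 \<noteq> 1" using False by presburger
    ultimately have "l_squ (Suc n) \<le> l_squ n" unfolding closed by simp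
    then show ?thesis using grow Suc.IH by (simp split: if_splits)
  qed
qed

section \<open>The maximum and its growth\<close>

lemma L_squ_eq_l_squ:
  assumes "n \<ge> 2"
  shows "L_squ n = l_squ n"
  unfolding L_squ_def
proof (rule Max_eqI)
  show le: "k \<le> l_squ n" if "k \<in> {num_leaves T | T. tree_like_polyomino n T}" for k
    using that num_leaves_le_l_squ[OF assms] by blast
  then show "finite {num_leaves T | T. tree_like_polyomino n T}"
    by (meson atMost_iff finite_atMost finite_subset subsetI)
  have "tree_like_polyomino n (induced_graph adj (comb n))"
    unfolding tree_like_polyomino_iff using comb_tree[of n] assms
    by (intro exI[of _ "comb n"]) auto
  moreover from this have "num_leaves (induced_graph adj (comb n)) = l_squ n"
    using num_leaves_le_l_squ[OF assms] l_squ_le_num_leaves_comb[OF assms] by (intro antisym)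
  ultimately show "l_squ n \<in> {num_leaves T | T. tree_like_polyomino n T}" by force
qed

theorem theorem3p4:
  shows "(\<forall>n\<ge>2. L_squ n = l_squ n) \<and>
         (\<lambda>n. real (L_squ n)) \<sim>[at_top] (\<lambda>n. (1/2) * real n)"
proof
  show "\<forall>n\<ge>2. L_squ n = l_squ n" using L_squ_eq_l_squ by blast
  have close: "\<bar>real (L_squ n) - (1/2) * real n\<bar> \<le> 2" if "n \<ge> 2" for n
  proof -
    have "n div 2 + 1 \<le> L_squ n" "L_squ n \<le> n div 2 + 2"
      using that by (simp_all add: L_squ_eq_l_squ l_squ_closed_form)
    then have "n \<le> 2 * L_squ n" "2 * L_squ n \<le> n + 4" by presburger+
    then have "real n \<le> 2 * real (L_squ n)" "2 * real (L_squ n) \<le> real n + 4" by linarith+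
    then show ?thesis by (simp add: abs_le_iff)
  qed
  have "(\<lambda>n. real (L_squ n) - (1/2) * real n) \<in> O(\<lambda>_. 1)"
    using close by (intro bigoI[of _ 2] eventually_at_top_linorderI[of 2]) simp
  also have "(\<lambda>_. 1) \<in> o(\<lambda>n. (1/2) * real n)"
    by real_asymp
  finally show "(\<lambda>n. real (L_squ n)) \<sim>[at_top] (\<lambda>n. (1/2) * real n)"
    by (simp add: asymp_equiv_altdef)
qed

end
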